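(* Suppose that the Banach space $X$ is 2-uniformly convex and smooth, and that there exists $L>0$ such that $$\langle x-y,Jx-Jy\rangle\le L\|x-y\|^2\qquad\text{for all }x,y\in X.$$ Then $X$ is isomorphic to a Hilbert space.
   Context: All Banach spaces are real. $J:X\to X^*$ is the normalized duality mapping, $\langle x,Jx\rangle=\|x\|^2=\|Jx\|^2$ (single-valued since $X$ is smooth). $X$ is 2-uniformly convex if there is $C>0$ with $\delta_X(\varepsilon)\ge C\varepsilon^2$ for all $\varepsilon>0$, where $\delta_X(\varepsilon)=\inf\{1-\frac{\|x+y\|}{2}:\|x\|=\|y\|=1,\ \|x-y\|=\varepsilon\}$. "Isomorphic" means linearly homeomorphic. *)

theory Defs
  imports "HOL-Analysis.Analysis"
begin

section \<open>Geometry of a real Banach space\<close>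

text \<open>The infimum is taken in the extended reals, so that it is \<open>\<infinity>\<close> over the empty set
  (as happens for \<open>\<epsilon> > 2\<close>, and in dimension at most one for most \<open>\<epsilon>\<close>).\<close>

definition modulus_of_convexity :: "'a::real_normed_vector itself \<Rightarrow> real \<Rightarrow> ereal" where
  "modulus_of_convexity _ \<epsilon> =
     Inf {ereal (1 - norm (x + y) / 2) |x y :: 'a. norm x = 1 \<and> norm y = 1 \<and> norm (x - y) = \<epsilon>}"

definition two_uniformly_convex :: "'a::real_normed_vector itself \<Rightarrow> bool" where
  "two_uniformly_convex X \<longleftrightarrow>
     (\<exists>C>0. \<forall>\<epsilon>>0. modulus_of_convexity X \<epsilon> \<ge> ereal (C * \<epsilon>\<^sup>2))"

text \<open>Smoothness: the norm is Gateaux differentiable on the unit sphere.\<close>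

definition smooth_space :: "'a::real_normed_vector itself \<Rightarrow> bool" where
  "smooth_space _ \<longleftrightarrow>
     (\<forall>x y :: 'a. norm x = 1 \<longrightarrow> norm y = 1 \<longrightarrow>
        (\<exists>l. ((\<lambda>t::real. (norm (x + t *\<^sub>R y) - norm x) / t) \<longlongrightarrow> l) (at 0)))"

text \<open>The dual space is the type of bounded linear maps into the reals, with the operator norm.
  The description is meaningful when the functional is unique, as it is in a smooth space.\<close>

definition duality_map :: "'a::real_normed_vector \<Rightarrow> 'a \<Rightarrow>\<^sub>L real" where
  "duality_map x = (THE f. blinfun_apply f x = (norm x)\<^sup>2 \<and> (norm x)\<^sup>2 = (norm f)\<^sup>2)"

section \<open>Hilbert spaces\<close>

text \<open>A theorem cannot assert the existence of a type of class \<^class>\<open>real_inner\<close>, so Hilbert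
  spaces are given by a carrier set with explicit operations.\<close>

locale real_inner_product_space =
  fixes V :: "'b set"
    and add :: "'b \<Rightarrow> 'b \<Rightarrow> 'b"
    and zero :: 'b
    and smul :: "real \<Rightarrow> 'b \<Rightarrow> 'b"
    and ip :: "'b \<Rightarrow> 'b \<Rightarrow> real"
  assumes add_closed: "\<And>x y. x \<in> V \<Longrightarrow> y \<in> V \<Longrightarrow> add x y \<in> V"
    and zero_closed: "zero \<in> V"
    and scale_closed: "\<And>a x. x \<in> V \<Longrightarrow> smul a x \<in> V"
    and add_assoc: "\<And>x y z. x \<in> V \<Longrightarrow> y \<in> V \<Longrightarrow> z \<in> V \<Longrightarrow> add (add x y) z = add x (add y z)"
    and add_commute: "\<And>x y. x \<in> V \<Longrightarrow> y \<in> V \<Longrightarrow> add x y = add y x"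
    and add_zero: "\<And>x. x \<in> V \<Longrightarrow> add x zero = x"
    and add_inverse: "\<And>x. x \<in> V \<Longrightarrow> \<exists>y\<in>V. add x y = zero"
    and scale_add_right: "\<And>a x y. x \<in> V \<Longrightarrow> y \<in> V \<Longrightarrow> smul a (add x y) = add (smul a x) (smul a y)"
    and scale_add_left: "\<And>a b x. x \<in> V \<Longrightarrow> smul (a + b) x = add (smul a x) (smul b x)"
    and scale_scale: "\<And>a b x. x \<in> V \<Longrightarrow> smul a (smul b x) = smul (a * b) x"
    and scale_one: "\<And>x. x \<in> V \<Longrightarrow> smul 1 x = x"
    and ip_commute: "\<And>x y. x \<in> V \<Longrightarrow> y \<in> V \<Longrightarrow> ip x y = ip y x"
    and ip_add_left: "\<And>x y z. x \<in> V \<Longrightarrow> y \<in> V \<Longrightarrow> z \<in> V \<Longrightarrow> ip (add x y) z = ip x z + ip y z"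
    and ip_scale_left: "\<And>a x y. x \<in> V \<Longrightarrow> y \<in> V \<Longrightarrow> ip (smul a x) y = a * ip x y"
    and ip_nonneg: "\<And>x. x \<in> V \<Longrightarrow> 0 \<le> ip x x"
    and ip_definite: "\<And>x. x \<in> V \<Longrightarrow> ip x x = 0 \<Longrightarrow> x = zero"
begin

text \<open>The value off the carrier is irrelevant; it is fixed because \<^locale>\<open>Metric_space\<close> asks for
  nonnegativity and symmetry on the whole type.\<close>

definition ip_dist :: "'b \<Rightarrow> 'b \<Rightarrow> real" where
  "ip_dist x y =
     (if x \<in> V \<and> y \<in> V then sqrt (ip (add x (smul (-1) y)) (add x (smul (-1) y))) else 0)"

lemma ip_add_right: "x \<in> V \<Longrightarrow> y \<in> V \<Longrightarrow> z \<in> V \<Longrightarrow> ip z (add x y) = ip z x + ip z y"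
  by (metis add_closed ip_add_left ip_commute)

lemma ip_scale_right: "x \<in> V \<Longrightarrow> y \<in> V \<Longrightarrow> ip x (smul a y) = a * ip x y"
  by (metis scale_closed ip_scale_left ip_commute)

lemma scale_zero_left: assumes "x \<in> V" shows "smul 0 x = zero"
proof (rule ip_definite)
  show "ip (smul 0 x) (smul 0 x) = 0"
    using assms by (simp add: ip_scale_left scale_closed)
qed (use assms in \<open>simp add: scale_closed\<close>)

lemma add_scale_minus: "x \<in> V \<Longrightarrow> add x (smul (-1) x) = zero"
  using scale_add_left[of x 1 "-1"] by (simp add: scale_zero_left scale_one)

lemma ip_combination:
  assumes "x \<in> V" "y \<in> V"
  shows "ip (add (smul a x) (smul b y)) (add (smul a x) (smul b y))
         = a\<^sup>2 * ip x x + 2 * (a * b) * ip x y + b\<^sup>2 * ip y y"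
  using assms ip_commute[of x y]
  by (simp add: ip_add_left ip_add_right ip_scale_left ip_scale_right add_closed scale_closed
      power2_eq_square algebra_simps)

lemma ip_Cauchy_Schwarz:
  assumes "x \<in> V" "y \<in> V"
  shows "ip x y \<le> sqrt (ip x x) * sqrt (ip y y)"
proof -
  define p q where "p = sqrt (ip x x)" and "q = sqrt (ip y y)"
  have pq: "p \<ge> 0" "q \<ge> 0" "ip x x = p\<^sup>2" "ip y y = q\<^sup>2"
    using assms by (auto simp: p_def q_def ip_nonneg)
  have "0 \<le> ip (add (smul q x) (smul (-p) y)) (add (smul q x) (smul (-p) y))"
    using assms by (simp add: ip_nonneg add_closed scale_closed)
  also have "\<dots> = 2 * (p * q) * (p * q - ip x y)"
    unfolding ip_combination[OF assms] pq by (simp add: power2_eq_square algebra_simps)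
  finally have *: "0 \<le> 2 * (p * q) * (p * q - ip x y)" .
  show ?thesis
  proof (cases "p * q = 0")
    case True
    then have "ip x x = 0 \<or> ip y y = 0"
      using pq by auto
    then have "x = zero \<or> y = zero"
      using assms ip_definite by blast
    moreover have "ip zero y = 0" "ip x zero = 0"
      using ip_scale_left[of y y 0] ip_scale_right[of x x 0] assms
      by (simp_all add: scale_zero_left)
    ultimately have "ip x y = 0" by metis
    then show ?thesis
      using assms by (simp add: ip_nonneg)
  next
    case False
    then have "p * q > 0" using pq by (simp add: order_less_le)
    with * show ?thesis
      unfolding p_def[symmetric] q_def[symmetric] by (simp add: zero_le_mult_iff)
  qed
qed

lemma ip_triangle:
  assumes "x \<in> V" "y \<in> V"
  shows "sqrt (ip (add x y) (add x y)) \<le> sqrt (ip x x) + sqrt (ip y y)"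
proof (rule real_le_lsqrt)
  show "ip (add x y) (add x y) \<le> (sqrt (ip x x) + sqrt (ip y y))\<^sup>2"
    using ip_combination[OF assms, of 1 1] ip_Cauchy_Schwarz[OF assms] assms
    by (simp add: scale_one power2_sum ip_nonneg)
qed (use assms in \<open>simp_all add: ip_nonneg\<close>)

lemma Metric_space_ip_dist: "Metric_space V ip_dist"
proof
  fix x y
  show "0 \<le> ip_dist x y"
    by (simp add: ip_dist_def ip_nonneg add_closed scale_closed)
  show "ip_dist x y = ip_dist y x"
  proof (cases "x \<in> V \<and> y \<in> V")
    case True
    then have xy: "x \<in> V" "y \<in> V" by auto
    show ?thesis
      using ip_combination[OF xy, of 1 "-1"] ip_combination[OF xy(2,1), of 1 "-1"]
      unfolding ip_dist_def ip_commute[OF xy] scale_one[OF xy(1)] scale_one[OF xy(2)] by simp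
  qed (auto simp: ip_dist_def)
next
  fix x y assume xy: "x \<in> V" "y \<in> V"
  let ?m = "smul (-1) y"
  have mV: "?m \<in> V" using xy by (simp add: scale_closed)
  have "x = y" if eq: "add x ?m = zero"
  proof -
    have "x = add x (add ?m y)"
      using xy mV add_commute[of ?m y] by (simp add: add_scale_minus add_zero)
    also have "\<dots> = add (add x ?m) y"
      using xy mV by (simp add: add_assoc)
    also have "\<dots> = y"
      unfolding eq add_commute[OF zero_closed xy(2)] by (rule add_zero[OF xy(2)])
    finally show ?thesis .
  qed
  moreover have "ip zero zero = 0"
    using ip_scale_left[OF zero_closed zero_closed, of 0]
    by (simp add: scale_zero_left zero_closed)
  ultimately have "ip (add x ?m) (add x ?m) = 0 \<longleftrightarrow> x = y"
    using ip_definite[OF add_closed[OF xy(1) mV]] add_scale_minus[OF xy(2)] by metis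
  then show "(ip_dist x y = 0) = (x = y)"
    using xy by (simp add: ip_dist_def)
next
  fix x y z assume xyz: "x \<in> V" "y \<in> V" "z \<in> V"
  let ?n = "smul (-1)"
  have cl: "?n y \<in> V" "?n z \<in> V" using xyz by (simp_all add: scale_closed)
  have "add (add x (?n y)) (add y (?n z)) = add x (add (add (?n y) y) (?n z))"
    using xyz cl by (simp add: add_assoc add_closed)
  also have "add (?n y) y = zero"
    unfolding add_commute[OF cl(1) xyz(2)] by (rule add_scale_minus[OF xyz(2)])
  also have "add zero (?n z) = ?n z"
    unfolding add_commute[OF zero_closed cl(2)] by (rule add_zero[OF cl(2)])
  finally have "add (add x (?n y)) (add y (?n z)) = add x (?n z)" .
  then show "ip_dist x z \<le> ip_dist x y + ip_dist y z"
    using ip_triangle[of "add x (?n y)" "add y (?n z)"] xyz cl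
    by (simp add: ip_dist_def add_closed)
qed

sublocale ip_metric: Metric_space V ip_dist
  by (rule Metric_space_ip_dist)

end

locale real_hilbert_space = real_inner_product_space V add zero smul ip
  for V :: "'b set" and add zero smul ip +
  assumes complete: "ip_metric.mcomplete"
begin

definition linear_homeomorphism :: "('c::real_normed_vector \<Rightarrow> 'b) \<Rightarrow> bool" where
  "linear_homeomorphism T \<longleftrightarrow>
     (\<forall>x y. T (x + y) = add (T x) (T y)) \<and>
     (\<forall>a x. T (a *\<^sub>R x) = smul a (T x)) \<and>
     homeomorphic_map euclidean ip_metric.mtopology T"

end

lemma real_hilbert_space_UNIV:
  "real_hilbert_space (UNIV :: 'h::{real_inner, complete_space} set) (+) 0 scaleR inner"
proof -
  interpret I: real_inner_product_space "UNIV :: 'h set" "(+)" 0 scaleR inner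
  proof
    show "\<exists>y\<in>UNIV. x + y = 0" for x :: 'h by (rule bexI[of _ "- x"]) auto
  qed (auto simp: algebra_simps inner_commute inner_left_distrib)
  have "I.ip_dist = dist"
    by (auto simp: fun_eq_iff I.ip_dist_def dist_norm norm_eq_sqrt_inner)
  then show ?thesis
    by unfold_locales (simp add: mcomplete_iff_complete complete_UNIV)
qed

text \<open>The Hilbert space is sought with its vectors in the type \<^typ>\<open>'a\<close>, but with arbitrary carrier,
  operations and inner product there. This is no restriction, since a space linearly homeomorphic to
  \<^typ>\<open>'a\<close> can be relabelled along the bijection: see \<open>isomorphic_to_hilbert_spaceI\<close>
  below.\<close>

definition isomorphic_to_hilbert_space :: "'a::real_normed_vector itself \<Rightarrow> bool" where
  "isomorphic_to_hilbert_space _ \<longleftrightarrow>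
     (\<exists>(V :: 'a set) add zero smul ip. real_hilbert_space V add zero smul ip \<and>
        (\<exists>T :: 'a \<Rightarrow> 'a. real_hilbert_space.linear_homeomorphism V add smul ip T))"

lemma isomorphic_to_hilbert_spaceI:
  fixes V :: "'b set" and T :: "'a::real_normed_vector \<Rightarrow> 'b"
  assumes H: "real_hilbert_space V add zero smul ip"
    and T: "real_hilbert_space.linear_homeomorphism V add smul ip T"
  shows "isomorphic_to_hilbert_space TYPE('a)"
proof -
  interpret H: real_hilbert_space V add zero smul ip by (fact H)
  define ip' where "ip' = (\<lambda>x y. ip (T x) (T y))"
  have Tadd: "T (x + y) = add (T x) (T y)" and Tscale: "T (a *\<^sub>R x) = smul a (T x)"
    and Thom: "homeomorphic_map euclidean H.ip_metric.mtopology T" for x y a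
    using T unfolding H.linear_homeomorphism_def by blast+
  have inj: "inj T" and img: "T ` UNIV = V"
    using Thom by (auto simp: homeomorphic_eq_everything_map)
  have TV: "T x \<in> V" for x using img by blast
  have T0: "T 0 = zero"
    using Tscale[of 0 0] by (simp add: H.scale_zero_left TV)
  interpret I: real_inner_product_space "UNIV :: 'a set" "(+)" 0 scaleR ip'
  proof
    fix x :: 'a
    show "\<exists>y\<in>UNIV. x + y = 0" by (rule bexI[of _ "- x"]) auto
    assume "ip' x x = 0"
    then have "T x = T 0" using H.ip_definite[OF TV] by (simp add: ip'_def T0)
    then show "x = 0" using inj by (simp add: inj_eq)
  qed (auto simp: ip'_def Tadd Tscale TV H.ip_add_left H.ip_scale_left H.ip_nonneg
        H.ip_commute[OF TV TV] algebra_simps)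
  have "T (x - y) = add (T x) (smul (-1) (T y))" for x y
    using Tadd[of x "(-1) *\<^sub>R y"] Tscale[of "-1" y] by simp
  then have dist: "I.ip_dist x y = H.ip_dist (T x) (T y)" for x y
    unfolding I.ip_dist_def H.ip_dist_def using TV by (simp only: ip'_def) simp
  have ball: "H.ip_metric.mball (T x) r = T ` I.ip_metric.mball x r" for x r
    unfolding H.ip_metric.mball_def I.ip_metric.mball_def using img TV
    by (auto simp: dist image_iff)
  have "openin I.ip_metric.mtopology U \<longleftrightarrow> open U" for U
  proof -
    have "openin H.ip_metric.mtopology (T ` U) \<longleftrightarrow> open U"
      using homeomorphic_map_openness_eq[OF Thom, of U] homeomorphic_map_openness[OF Thom, of U]
      by simp
    moreover have "openin H.ip_metric.mtopology (T ` U) \<longleftrightarrow> openin I.ip_metric.mtopology U"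
    proof -
      have "(\<forall>y. y \<in> T ` U \<longrightarrow> (\<exists>r>0. H.ip_metric.mball y r \<subseteq> T ` U)) \<longleftrightarrow>
            (\<forall>x. x \<in> U \<longrightarrow> (\<exists>r>0. H.ip_metric.mball (T x) r \<subseteq> T ` U))"
        by blast
      then show ?thesis
        using TV unfolding H.ip_metric.openin_mtopology I.ip_metric.openin_mtopology
        by (auto simp: ball inj_image_subset_iff[OF inj])
    qed
    ultimately show ?thesis by blast
  qed
  then have top: "I.ip_metric.mtopology = euclidean"
    by (simp add: topology_eq)
  have "I.ip_metric.mcomplete"
    unfolding I.ip_metric.mcomplete_def
  proof (intro allI impI)
    fix \<sigma> assume "I.ip_metric.MCauchy \<sigma>"
    then have "H.ip_metric.MCauchy (\<lambda>n. T (\<sigma> n))"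
      using TV by (auto simp: H.ip_metric.MCauchy_def I.ip_metric.MCauchy_def dist)
    then obtain l where l: "limitin H.ip_metric.mtopology (\<lambda>n. T (\<sigma> n)) l sequentially"
      using H.complete H.ip_metric.mcomplete_def by blast
    then have "l \<in> V" by (simp add: H.ip_metric.limit_metric_sequentially)
    then obtain a where "l = T a" using img by blast
    with l have "limitin I.ip_metric.mtopology \<sigma> a sequentially"
      by (simp add: H.ip_metric.limit_metric_sequentially I.ip_metric.limit_metric_sequentially
          dist TV)
    then show "\<exists>x. limitin I.ip_metric.mtopology \<sigma> x sequentially" by blast
  qed
  then interpret I: real_hilbert_space "UNIV :: 'a set" "(+)" 0 scaleR ip'
    by unfold_locales
  have "I.linear_homeomorphism (\<lambda>x. x)"
    unfolding I.linear_homeomorphism_def top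
    using homeomorphic_map_id[of euclidean euclidean] by (simp add: id_def)
  then show ?thesis
    unfolding isomorphic_to_hilbert_space_def
    using I.real_hilbert_space_axioms by blast
qed

end

theory Submission
  imports Defs
begin

text \<open>The second differences \<open>g\<^sub>y x = (norm (x + y))\<^sup>2 + (norm (x - y))\<^sup>2 - 2 * (norm x)\<^sup>2\<close> lie between
  two positive constant multiples of \<open>(norm y)\<^sup>2\<close>: below by 2-uniform convexity, above because \<open>J\<close> is a
  subgradient of \<open>(norm x)\<^sup>2 / 2\<close> and satisfies the one-sided Lipschitz condition. For \<open>x\<close>-averages
  \<open>Q y\<close> of \<open>g\<^sub>y\<close> with respect to a translation-invariant mean, the identity
  \<open>g\<^bsub>y+z\<^esub> x + g\<^bsub>y-z\<^esub> x = g\<^sub>y (x + z) + g\<^sub>y (x - z) + 2 * g\<^sub>z x\<close> becomes the parallelogram law, so \<open>Q\<close> is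
  the square of an equivalent Hilbertian norm. This replaces Kwapien's theorem. Only the values \<open>Q y\<close>
  are needed, and they are obtained from almost invariant finite averages by Tychonoff's theorem.\<close>

section \<open>Invariant means and the parallelogram law\<close>

text \<open>The last clause encodes positivity and normalisation at once: applied to a constant and
  to its negative, it fixes the value on constants. The domain is all real functions; boundedness
  enters only where almost invariance is measured.\<close>

definition mean :: "(('a \<Rightarrow> real) \<Rightarrow> real) \<Rightarrow> bool" where
  "mean A \<longleftrightarrow> (\<forall>g h. A (\<lambda>x. g x + h x) = A g + A h) \<and> (\<forall>c g. A (\<lambda>x. c * g x) = c * A g) \<and>
     (\<forall>g a. (\<forall>x. a \<le> g x) \<longrightarrow> a \<le> A g)"

lemma mean_add: "mean A \<Longrightarrow> A (\<lambda>x. g x + h x) = A g + A h"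
  and mean_scale: "mean A \<Longrightarrow> A (\<lambda>x. c * g x) = c * A g"
  and mean_lower: "mean A \<Longrightarrow> (\<And>x. a \<le> g x) \<Longrightarrow> a \<le> A g"
  unfolding mean_def by blast+

lemma mean_upper:
  assumes "mean A" "\<And>x. g x \<le> b"
  shows "A g \<le> b"
  using mean_lower[OF assms(1), of "- b" "\<lambda>x. -1 * g x"] mean_scale[OF assms(1), of "-1" g] assms(2)
  by simp

lemma mean_abs_le:
  assumes "mean A" "\<And>x. \<bar>g x\<bar> \<le> b"
  shows "\<bar>A g\<bar> \<le> b"
  using mean_upper[OF assms(1), of g b] mean_lower[OF assms(1), of "- b" g] assms(2)
  by (simp add: abs_le_iff minus_le_iff)

lemma mean_average:
  fixes z :: "'a::real_vector"
  assumes "mean A" "N > 0"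
  shows "mean (\<lambda>g. (\<Sum>i<N. A (\<lambda>x. g (x + real i *\<^sub>R z))) / real N)"
  unfolding mean_def
proof (intro conjI allI impI)
  fix g :: "'a \<Rightarrow> real" and a assume a: "\<forall>x. a \<le> g x"
  have "real N * a \<le> (\<Sum>i<N. A (\<lambda>x. g (x + real i *\<^sub>R z)))"
    using sum_bounded_below[of "{..<N}" a "\<lambda>i. A (\<lambda>x. g (x + real i *\<^sub>R z))"]
      mean_lower[OF assms(1)] a by auto
  then show "a \<le> (\<Sum>i<N. A (\<lambda>x. g (x + real i *\<^sub>R z))) / real N"
    using assms(2) by (simp add: field_simps)
qed (simp_all add: mean_add[OF assms(1)] mean_scale[OF assms(1)] sum.distrib add_divide_distrib
    sum_distrib_left)

text \<open>Induction on the set of directions, starting from a point evaluation. Averaging along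
  multiples of the new direction telescopes to a small boundary term, and because translations
  commute it does not spoil almost invariance in the old directions.\<close>

lemma ex_almost_invariant_mean:
  fixes Z :: "'a::real_vector set"
  assumes "finite Z" "\<epsilon> > 0"
  shows "\<exists>A. mean A \<and>
    (\<forall>z\<in>Z. \<forall>g b. (\<forall>x. \<bar>g x\<bar> \<le> b) \<longrightarrow> \<bar>A (\<lambda>x. g (x + z)) - A g\<bar> \<le> \<epsilon> * b)"
  using assms(1)
proof induction
  case empty
  have "mean (\<lambda>g. g (0::'a))" by (simp add: mean_def)
  then show ?case by blast
next
  case (insert z Z)
  then obtain A where A: "mean A"
    "\<And>w g b. w \<in> Z \<Longrightarrow> (\<And>x. \<bar>g x\<bar> \<le> b) \<Longrightarrow> \<bar>A (\<lambda>x. g (x + w)) - A g\<bar> \<le> \<epsilon> * b"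
    by blast
  \<comment> \<open>The telescoped average leaves two boundary terms, each at most \<open>b\<close>,
    divided by \<open>N\<close>; hence the threshold \<open>2 / \<epsilon>\<close>.\<close>
  obtain N :: nat where N: "real N > 2 / \<epsilon>" using reals_Archimedean2 by blast
  with \<open>\<epsilon> > 0\<close> have N0: "N > 0" and N\<epsilon>: "2 \<le> \<epsilon> * real N"
    by (auto simp: field_simps intro!: Nat.gr0I)
  define A' where "A' = (\<lambda>g. (\<Sum>i<N. A (\<lambda>x. g (x + real i *\<^sub>R z))) / real N)"
  have "\<bar>A' (\<lambda>x. g (x + w)) - A' g\<bar> \<le> \<epsilon> * b"
    if w: "w \<in> insert z Z" and b: "\<And>x. \<bar>g x\<bar> \<le> b" for w g b
  proof (cases "w = z")
    case True
    have b0: "b \<ge> 0" using b[of 0] by linarith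
    define G where "G i = A (\<lambda>x. g (x + real i *\<^sub>R z))" for i
    have "A' (\<lambda>x. g (x + w)) - A' g = (\<Sum>i<N. G (Suc i) - G i) / N"
      unfolding A'_def G_def sum_subtractf diff_divide_distrib True
      by (simp add: algebra_simps)
    also have "\<dots> = (G N - G 0) / N"
      by (simp add: sum_lessThan_telescope)
    finally have eq: "A' (\<lambda>x. g (x + w)) - A' g = (G N - G 0) / N" .
    have "\<bar>G i\<bar> \<le> b" for i
      unfolding G_def using b by (intro mean_abs_le[OF A(1)])
    then have "\<bar>G N - G 0\<bar> \<le> 2 * b"
      using abs_triangle_ineq4[of "G N" "G 0"] by (metis add_mono mult_2 order.trans)
    also have "\<dots> \<le> \<epsilon> * real N * b"
      using N\<epsilon> b0 by (rule mult_right_mono)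
    finally show ?thesis
      using N0 unfolding eq by (simp add: field_simps)
  next
    case False
    then have wZ: "w \<in> Z" using w by simp
    have "\<bar>A (\<lambda>x. g (x + real i *\<^sub>R z + w)) - A (\<lambda>x. g (x + real i *\<^sub>R z))\<bar> \<le> \<epsilon> * b" for i
      using A(2)[OF wZ, of "\<lambda>x. g (x + real i *\<^sub>R z)" b] b by (simp add: add_ac)
    then have "\<bar>\<Sum>i<N. A (\<lambda>x. g (x + real i *\<^sub>R z + w)) - A (\<lambda>x. g (x + real i *\<^sub>R z))\<bar>
        \<le> real N * (\<epsilon> * b)"
      by (intro order.trans[OF sum_abs] order.trans[OF sum_bounded_above[where K = "\<epsilon> * b"]]) auto
    then show ?thesis
      using N0 unfolding A'_def sum_subtractf
      by (simp add: diff_divide_distrib[symmetric] field_simps)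
  qed
  moreover have "mean A'"
    unfolding A'_def by (rule mean_average[OF A(1) N0])
  ultimately show ?case by blast
qed

section \<open>Compactness and exact invariance in the limit\<close>

text \<open>Tychonoff's theorem: the box is a product of compact intervals, and the topology of the
  function type is the product topology.\<close>

lemma compact_function_box: "compact {Q :: 'a \<Rightarrow> real. \<forall>y. l y \<le> Q y \<and> Q y \<le> u y}"
proof -
  have "compactin (product_topology (\<lambda>_. euclidean) UNIV) (PiE UNIV (\<lambda>y::'a. {l y..u y}))"
    by (simp add: compactin_PiE)
  moreover have "PiE UNIV (\<lambda>y. {l y..u y}) = {Q :: 'a \<Rightarrow> real. \<forall>y. l y \<le> Q y \<and> Q y \<le> u y}"
    by auto
  ultimately show ?thesis by (simp add: euclidean_product_topology)
qed

text \<open>Finitely many instances of the parallelogram law hold up to given errors for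
  \<open>Q y = A (g y)\<close> with \<open>A\<close> almost invariant. The finite intersection
  property then gives one \<open>Q\<close> in the box satisfying all instances with every positive
  error.\<close>

lemma ex_parallelogram_function:
  fixes f :: "'a::real_vector \<Rightarrow> real"
  assumes lo: "\<And>x y. l y \<le> f (x + y) + f (x - y) - 2 * f x"
    and up: "\<And>x y. f (x + y) + f (x - y) - 2 * f x \<le> u y"
  obtains Q where "\<And>y. l y \<le> Q y" "\<And>y. Q y \<le> u y"
    "\<And>y z. Q (y + z) + Q (y - z) = 2 * Q y + 2 * Q z"
proof -
  define g where "g y x = f (x + y) + f (x - y) - 2 * f x" for x y
  define B where "B y = \<bar>l y\<bar> + \<bar>u y\<bar>" for y
  have gB: "\<bar>g y x\<bar> \<le> B y" for x y
    using lo[of y x] up[where x = x and y = y] unfolding g_def B_def by linarith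
  define K where "K = {Q. \<forall>y. l y \<le> Q y \<and> Q y \<le> u y}"
  \<comment> \<open>The error is scaled by \<open>2 * B y\<close> because two translates of
    \<open>g y\<close> are compared with \<open>g y\<close>, and \<open>B y\<close> bounds
    \<open>g y\<close>.\<close>
  define S where "S = (\<lambda>(y, z, e). {Q. \<bar>Q (y + z) + Q (y - z) - 2 * Q y - 2 * Q z\<bar> \<le> e * (2 * B y)})"
  have "K \<inter> (\<Inter>p \<in> UNIV \<times> UNIV \<times> {0<..}. S p) \<noteq> {}"
  proof (rule compact_imp_fip_image)
    show "compact K" unfolding K_def by (rule compact_function_box)
    show "closed (S p)" for p
      unfolding S_def case_prod_unfold
      by (intro closed_Collect_le continuous_intros)
        (auto intro!: continuous_intros continuous_on_product_coordinates)
  next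
    fix I :: "('a \<times> 'a \<times> real) set"
    assume I: "finite I" "I \<subseteq> UNIV \<times> UNIV \<times> {0<..}"
    define Z where "Z = (\<lambda>(y, z, e). z) ` I \<union> (\<lambda>(y, z, e). - z) ` I"
    \<comment> \<open>Inserting 1 keeps the set nonempty when \<open>I\<close> is empty, so that
      \<open>Min\<close> is meaningful.\<close>
    define \<epsilon> where "\<epsilon> = Min (insert 1 ((\<lambda>(y, z, e). e) ` I))"
    have \<epsilon>: "\<epsilon> > 0" and \<epsilon>e: "\<And>y z e. (y, z, e) \<in> I \<Longrightarrow> \<epsilon> \<le> e"
      unfolding \<epsilon>_def using I by (auto simp: image_iff intro!: Min_le)
    have "finite Z" unfolding Z_def using I by simp
    from ex_almost_invariant_mean[OF this \<epsilon>] obtain A where A: "mean A"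
      "\<And>z h b. z \<in> Z \<Longrightarrow> (\<And>x. \<bar>h x\<bar> \<le> b) \<Longrightarrow> \<bar>A (\<lambda>x. h (x + z)) - A h\<bar> \<le> \<epsilon> * b"
      by blast
    define Q where "Q y = A (g y)" for y
    have "Q \<in> K"
      unfolding K_def Q_def g_def using lo up
      by (auto intro: mean_lower[OF A(1)] mean_upper[OF A(1)])
    moreover have "Q \<in> S p" if p: "p \<in> I" for p
    proof -
      obtain y z e where yze: "p = (y, z, e)" by (cases p)
      have z: "z \<in> Z" "- z \<in> Z" unfolding Z_def using p yze by force+
      have "(\<lambda>x. g (y + z) x + g (y - z) x) = (\<lambda>x. (g y (x + z) + g y (x + - z)) + 2 * g z x)"
        by (auto simp: g_def algebra_simps)
      then have "Q (y + z) + Q (y - z) = A (\<lambda>x. g y (x + z)) + A (\<lambda>x. g y (x + - z)) + 2 * Q z"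
        unfolding Q_def mean_add[OF A(1), symmetric] mean_scale[OF A(1), symmetric] by simp
      moreover have "\<bar>A (\<lambda>x. g y (x + z)) - Q y\<bar> \<le> \<epsilon> * B y"
        "\<bar>A (\<lambda>x. g y (x + - z)) - Q y\<bar> \<le> \<epsilon> * B y"
        unfolding Q_def using A(2)[OF z(1), of "g y"] A(2)[OF z(2), of "g y"] gB by blast+
      ultimately have "\<bar>Q (y + z) + Q (y - z) - 2 * Q y - 2 * Q z\<bar> \<le> \<epsilon> * (2 * B y)"
        by linarith
      also have "\<dots> \<le> e * (2 * B y)"
        using \<epsilon>e p yze by (intro mult_right_mono) (auto simp: B_def)
      finally show ?thesis by (simp add: S_def yze)
    qed
    ultimately show "K \<inter> (\<Inter>p\<in>I. S p) \<noteq> {}" by blast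
  qed
  then obtain Q where QK: "Q \<in> K" and QS: "\<And>y z e. e > 0 \<Longrightarrow> Q \<in> S (y, z, e)"
    by fastforce
  have "Q (y + z) + Q (y - z) = 2 * Q y + 2 * Q z" for y z
  proof -
    have "\<bar>Q (y + z) + Q (y - z) - 2 * Q y - 2 * Q z\<bar> \<le> 0 + d" if "d > 0" for d
    proof -
      have B0: "2 * B y \<ge> 0" by (simp add: B_def)
      \<comment> \<open>The added 1 keeps the divisor positive even if \<open>B y\<close> is
        0.\<close>
      have "\<bar>Q (y + z) + Q (y - z) - 2 * Q y - 2 * Q z\<bar> \<le> d / (2 * B y + 1) * (2 * B y)"
        using QS[of "d / (2 * B y + 1)" y z] B0 that by (simp add: S_def)
      also have "\<dots> \<le> d"
        using B0 that by (simp add: field_simps)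
      finally show ?thesis by simp
    qed
    then have "\<bar>Q (y + z) + Q (y - z) - 2 * Q y - 2 * Q z\<bar> \<le> 0"
      by (rule field_le_epsilon)
    then show ?thesis by linarith
  qed
  with QK that show ?thesis unfolding K_def by blast
qed

section \<open>The Jordan--von Neumann construction\<close>

lemma additive_bounded_imp_zero:
  fixes h :: "real \<Rightarrow> real"
  assumes "Modules.additive h" "\<And>t. \<bar>h t\<bar> \<le> M"
  shows "h t = 0"
proof (rule ccontr)
  assume "h t \<noteq> 0"
  interpret Modules.additive h by fact
  have mult: "h (real n * t) = real n * h t" for n
    by (induction n) (simp_all add: zero add distrib_right)
  obtain n :: nat where "real n > M / \<bar>h t\<bar>" using reals_Archimedean2 by blast
  with \<open>h t \<noteq> 0\<close> have "\<bar>h (real n * t)\<bar> > M"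
    unfolding mult by (simp add: abs_mult field_simps)
  with assms(2) show False by (meson not_less)
qed

text \<open>Subtracting the candidate linear map leaves an additive function that vanishes on the
  integers, hence has period 1. The bound on the unit interval thus becomes global, and a bounded
  additive function is zero.\<close>

lemma additive_locally_bounded_imp_linear:
  fixes g :: "real \<Rightarrow> real"
  assumes "Modules.additive g" and M: "\<And>t. 0 \<le> t \<Longrightarrow> t \<le> 1 \<Longrightarrow> \<bar>g t\<bar> \<le> M"
  shows "g t = t * g 1"
proof -
  interpret g: Modules.additive g by fact
  define h where "h t = g t - t * g 1" for t
  have addh: "Modules.additive h"
    by standard (simp add: h_def g.add algebra_simps)
  interpret h: Modules.additive h by (fact addh)
  have h1: "h (real n) = 0" for n
    by (induction n) (simp_all add: h.zero h.add, simp add: h_def)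
  have "h (of_int k) = 0" for k
    by (cases k) (simp_all add: h1 h.minus del: of_nat_Suc)
  then have hfrac: "h t = h (frac t)" for t
    by (simp add: frac_def h.diff)
  have "\<bar>h t\<bar> \<le> M + \<bar>g 1\<bar>" for t
  proof -
    have f: "0 \<le> frac t" "frac t \<le> 1" using frac_lt_1[of t] by auto
    have "\<bar>frac t * g 1\<bar> \<le> \<bar>g 1\<bar>"
      using f by (simp add: abs_mult mult_left_le_one_le)
    with M[OF f] show ?thesis
      unfolding hfrac[of t] unfolding h_def by linarith
  qed
  from additive_bounded_imp_zero[OF addh this, of t] show ?thesis
    by (simp add: h_def)
qed

text \<open>Polarisation gives additivity from the parallelogram law alone. Real homogeneity uses
  the quadratic bound: it makes \<open>B (t *\<^sub>R x) y\<close> bounded for \<open>t\<close> in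
  the unit interval, where additivity forces linearity.\<close>

lemma parallelogram_imp_inner_product:
  fixes Q :: "'a::real_normed_vector \<Rightarrow> real"
  assumes par: "\<And>x y. Q (x + y) + Q (x - y) = 2 * Q x + 2 * Q y"
    and nonneg: "\<And>x. 0 \<le> Q x" and bound: "\<And>x. Q x \<le> C * (norm x)\<^sup>2"
  obtains B where "\<And>x y. B x y = B y x" "\<And>x y z. B (x + y) z = B x z + B y z"
    "\<And>a x y. B (a *\<^sub>R x) y = a * B x y" "\<And>x. B x x = Q x"
proof -
  define B where "B x y = (Q (x + y) - Q (x - y)) / 4" for x y
  have B4: "4 * B x y = Q (x + y) - Q (x - y)" for x y by (simp add: B_def)
  have Q0: "Q 0 = 0" using par[of 0 0] by simp
  have Qm: "Q (- x) = Q x" for x using par[of 0 x] Q0 by simp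
  have comm: "B x y = B y x" for x y
    using Qm[of "x - y"] by (simp add: B_def add.commute)
  have B0: "B 0 z = 0" for z by (simp add: B_def Qm)
  have sum_diff: "B (x + y) z + B (x - y) z = 2 * B x z" for x y z
  proof -
    have e: "x + z + y = x + y + z" "x + z - y = x - y + z"
      "x - z + y = x + y - z" "x - z - y = x - y - z"
      by simp_all
    show ?thesis
      using par[of "x + z" y] par[of "x - z" y] B4[of "x + y" z] B4[of "x - y" z] B4[of x z]
      unfolding e by linarith
  qed
  have dbl: "B (2 *\<^sub>R x) z = 2 * B x z" for x z
    using sum_diff[of x x z] by (simp add: B0 scaleR_2)
  have add: "B (x + y) z = B x z + B y z" for x y z
  proof -
    \<comment> \<open>Half-sum and half-difference turn \<open>sum_diff\<close> into additivity,
      with \<open>dbl\<close> absorbing the factor 2.\<close>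
    have h: "(1/2) *\<^sub>R (x + y) + (1/2) *\<^sub>R (x - y) = x" "(1/2) *\<^sub>R (x + y) - (1/2) *\<^sub>R (x - y) = y"
      by (simp_all add: algebra_simps flip: scaleR_add_left)
    show ?thesis
      using sum_diff[of "(1/2) *\<^sub>R (x + y)" "(1/2) *\<^sub>R (x - y)" z] dbl[of "(1/2) *\<^sub>R (x + y)" z]
      unfolding h by simp
  qed
  \<comment> \<open>The sign of \<open>C\<close> comes from squeezing \<open>Q\<close> at a nonzero
    vector, so the zero vector is treated apart.\<close>
  have C0: "0 \<le> C" if "x \<noteq> 0" for x :: 'a
    using order.trans[OF nonneg[of x] bound[of x]] that by (simp add: zero_le_mult_iff)
  have scale: "B (a *\<^sub>R x) y = a * B x y" for a x y
  proof (cases "x = 0")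
    case False
    have "Modules.additive (\<lambda>t. B (t *\<^sub>R x) y)"
      by standard (simp add: scaleR_add_left add)
    moreover have "\<bar>B (t *\<^sub>R x) y\<bar> \<le> C * (norm x + norm y)\<^sup>2" if "0 \<le> t" "t \<le> 1" for t
    proof -
      have "norm (t *\<^sub>R x) \<le> norm x"
        using that by (simp add: mult_left_le_one_le)
      then have "norm (t *\<^sub>R x + y) \<le> norm x + norm y" "norm (t *\<^sub>R x - y) \<le> norm x + norm y"
        using norm_triangle_ineq[of "t *\<^sub>R x" y] norm_triangle_ineq4[of "t *\<^sub>R x" y] by linarith+
      then have "C * (norm (t *\<^sub>R x + y))\<^sup>2 \<le> C * (norm x + norm y)\<^sup>2"
        "C * (norm (t *\<^sub>R x - y))\<^sup>2 \<le> C * (norm x + norm y)\<^sup>2"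
        using C0[OF False] by (auto intro!: mult_left_mono power_mono)
      then show ?thesis
        using bound[of "t *\<^sub>R x + y"] bound[of "t *\<^sub>R x - y"] nonneg[of "t *\<^sub>R x + y"]
          nonneg[of "t *\<^sub>R x - y"] B4[of "t *\<^sub>R x" y]
        by linarith
    qed
    ultimately show ?thesis
      using additive_locally_bounded_imp_linear[of "\<lambda>t. B (t *\<^sub>R x) y" _ a] by auto
  qed (simp add: B0)
  have "B x x = Q x" for x
    using par[of x x] by (simp add: B_def Q0)
  with that comm add scale show ?thesis by blast
qed

section \<open>Hilbert structure from an equivalent inner product\<close>

text \<open>The vector space is kept and only the inner product is new. Two-sided comparison of the
  distances transfers open sets and Cauchy sequences, so the identity is the isomorphism.\<close>

lemma isomorphic_to_hilbert_space_equivalent_inner_product: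
  fixes B :: "'a::banach \<Rightarrow> 'a \<Rightarrow> real"
  assumes comm: "\<And>x y. B x y = B y x"
    and add: "\<And>x y z. B (x + y) z = B x z + B y z"
    and scale: "\<And>a x y. B (a *\<^sub>R x) y = a * B x y"
    and c: "c > 0" "\<And>x. c * (norm x)\<^sup>2 \<le> B x x"
    and C: "\<And>x. B x x \<le> C * (norm x)\<^sup>2"
  shows "isomorphic_to_hilbert_space TYPE('a)"
proof -
  have nonneg: "0 \<le> B x x" for x
    using c(2)[of x] c(1) by (smt (verit) mult_nonneg_nonneg zero_le_power2)
  interpret I: real_inner_product_space "UNIV :: 'a set" "(+)" 0 scaleR B
  proof
    fix x :: 'a
    show "\<exists>y\<in>UNIV. x + y = 0" by (rule bexI[of _ "- x"]) auto
    assume "B x x = 0"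
    then show "x = 0" using c(2)[of x] c(1) by (simp add: mult_le_0_iff)
  qed (auto simp: add scale nonneg algebra_simps intro: comm)
  \<comment> \<open>The maximum with 1 keeps \<open>b\<close> positive, since radii are divided by
    it.\<close>
  define a b where "a = sqrt c" and "b = sqrt (max C 1)"
  have a0: "a > 0" and b0: "b > 0" using c(1) by (auto simp: a_def b_def)
  have d: "I.ip_dist x y = sqrt (B (x - y) (x - y))" for x y
    by (simp add: I.ip_dist_def)
  have lower: "a * dist x y \<le> I.ip_dist x y" for x y
    unfolding d a_def dist_norm
    using real_sqrt_le_mono[OF c(2)[of "x - y"]] by (simp add: real_sqrt_mult)
  have upper: "I.ip_dist x y \<le> b * dist x y" for x y
  proof -
    have "B (x - y) (x - y) \<le> max C 1 * (norm (x - y))\<^sup>2"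
      by (rule order.trans[OF C]) (auto intro: mult_right_mono)
    then show ?thesis
      unfolding d b_def dist_norm using real_sqrt_le_mono by (fastforce simp: real_sqrt_mult)
  qed
  have "openin I.ip_metric.mtopology U \<longleftrightarrow> open U" for U
  proof -
    have "(\<exists>r>0. I.ip_metric.mball x r \<subseteq> U) \<longleftrightarrow> (\<exists>r>0. ball x r \<subseteq> U)" for x
    proof
      assume "\<exists>r>0. I.ip_metric.mball x r \<subseteq> U"
      then obtain r where r: "r > 0" "I.ip_metric.mball x r \<subseteq> U" by blast
      have "ball x (r / b) \<subseteq> I.ip_metric.mball x r"
        using b0 order.strict_trans1[OF upper]
        by (auto simp: I.ip_metric.mball_def field_simps)
      with r b0 show "\<exists>r>0. ball x r \<subseteq> U"
        by (meson divide_pos_pos order.trans)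
    next
      assume "\<exists>r>0. ball x r \<subseteq> U"
      then obtain r where r: "r > 0" "ball x r \<subseteq> U" by blast
      have "I.ip_metric.mball x (a * r) \<subseteq> ball x r"
        using a0 order.strict_trans1[OF lower]
        by (fastforce simp: I.ip_metric.mball_def)
      with r a0 show "\<exists>r>0. I.ip_metric.mball x r \<subseteq> U"
        by (meson mult_pos_pos order.trans)
    qed
    then show ?thesis
      by (auto simp: I.ip_metric.openin_mtopology open_contains_ball)
  qed
  then have top: "I.ip_metric.mtopology = euclidean"
    by (simp add: topology_eq)
  have "I.ip_metric.mcomplete"
    unfolding I.ip_metric.mcomplete_def
  proof (intro allI impI)
    fix \<sigma> :: "nat \<Rightarrow> 'a" assume \<sigma>: "I.ip_metric.MCauchy \<sigma>"
    have "Cauchy \<sigma>"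
    proof (rule metric_CauchyI)
      fix e :: real assume "e > 0"
      with \<sigma> a0 obtain N where N: "\<And>m n. N \<le> m \<Longrightarrow> N \<le> n \<Longrightarrow> I.ip_dist (\<sigma> m) (\<sigma> n) < a * e"
        unfolding I.ip_metric.MCauchy_def by (meson mult_pos_pos)
      have "dist (\<sigma> m) (\<sigma> n) < e" if "m \<ge> N" "n \<ge> N" for m n
        using order.strict_trans1[OF lower N[OF that]] a0 by simp
      then show "\<exists>M. \<forall>m\<ge>M. \<forall>n\<ge>M. dist (\<sigma> m) (\<sigma> n) < e" by blast
    qed
    then obtain x where "\<sigma> \<longlonglongrightarrow> x" using Cauchy_convergent convergent_def by blast
    then show "\<exists>x. limitin I.ip_metric.mtopology \<sigma> x sequentially"
      unfolding top by auto
  qed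
  then interpret I: real_hilbert_space "UNIV :: 'a set" "(+)" 0 scaleR B
    by unfold_locales
  have "I.linear_homeomorphism (\<lambda>x. x)"
    unfolding I.linear_homeomorphism_def top
    using homeomorphic_map_id[of euclidean euclidean] by (simp add: id_def)
  then show ?thesis
    by (rule isomorphic_to_hilbert_spaceI[OF I.real_hilbert_space_axioms])
qed

section \<open>The duality mapping of a smooth space\<close>

text \<open>Smoothness supplies derivatives only in unit directions; rescaling \<open>t\<close>
  reaches all directions, and negative \<open>s\<close> later gives oddness of the
  derivative.\<close>

lemma tendsto_norm_quotient_scale:
  fixes x v :: "'a::real_normed_vector"
  assumes "((\<lambda>t. (norm (x + t *\<^sub>R v) - norm x) / t) \<longlongrightarrow> l) (at 0)"
  shows "((\<lambda>t. (norm (x + t *\<^sub>R s *\<^sub>R v) - norm x) / t) \<longlongrightarrow> s * l) (at 0)"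
proof (cases "s = 0")
  case False
  have "((\<lambda>t. t * s) \<longlongrightarrow> 0) (at 0)"
    by (rule tendsto_eq_intros refl)+ simp
  then have "filterlim (\<lambda>t. t * s) (at 0) (at 0)"
    using False by (auto simp: filterlim_at eventually_at intro!: exI[of _ 1])
  from tendsto_mult_left[OF filterlim_compose[OF assms this], of s] False
  show ?thesis by simp
qed simp

text \<open>Smoothness makes Hahn--Banach unnecessary: the norming functional at \<open>x\<close> is the Gateaux
  derivative of the norm, which is sublinear as a limit of convex quotients and odd because the
  limit is two-sided.\<close>

lemma ex_norming_functional:
  fixes x :: "'a::real_normed_vector"
  assumes "smooth_space TYPE('a)" "norm x = 1"
  shows "\<exists>!f :: 'a \<Rightarrow>\<^sub>L real. blinfun_apply f x = 1 \<and> norm f = 1"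
proof -
  have "\<exists>l. ((\<lambda>t. (norm (x + t *\<^sub>R y) - norm x) / t) \<longlongrightarrow> l) (at 0)" for y
  proof (cases "y = 0")
    case False
    then have "norm (sgn y) = 1" by (simp add: norm_sgn)
    with assms obtain l where "((\<lambda>t. (norm (x + t *\<^sub>R sgn y) - norm x) / t) \<longlongrightarrow> l) (at 0)"
      unfolding smooth_space_def by blast
    from tendsto_norm_quotient_scale[OF this, of "norm y"] False show ?thesis
      by (auto simp: sgn_div_norm)
  qed auto
  then obtain D where D: "\<And>y. ((\<lambda>t. (norm (x + t *\<^sub>R y) - norm x) / t) \<longlongrightarrow> D y) (at 0)"
    by metis
  then have Dr: "((\<lambda>t. (norm (x + t *\<^sub>R y) - norm x) / t) \<longlongrightarrow> D y) (at_right 0)" for y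
    by (rule tendsto_mono[OF at_le, rotated]) simp
  have Dscale: "D (s *\<^sub>R y) = s * D y" for s y
    using tendsto_unique[OF _ D tendsto_norm_quotient_scale[OF D]] by simp
  have Dsub: "D (y + z) \<le> D y + D z" for y z
  proof -
    \<comment> \<open>Writing the sum as twice a midpoint reduces subadditivity to midpoint
      convexity of the norm at a common \<open>t > 0\<close>.\<close>
    have "D (2 *\<^sub>R ((1/2) *\<^sub>R y + (1/2) *\<^sub>R z)) \<le> D y + D z"
      unfolding Dscale
    proof (rule tendsto_le[OF _ tendsto_add[OF Dr[of y] Dr[of z]] tendsto_mult_left[OF Dr]])
      show "\<forall>\<^sub>F t in at_right 0.
          2 * ((norm (x + t *\<^sub>R ((1/2) *\<^sub>R y + (1/2) *\<^sub>R z)) - norm x) / t)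
          \<le> (norm (x + t *\<^sub>R y) - norm x) / t + (norm (x + t *\<^sub>R z) - norm x) / t"
        using eventually_at_right_less[of 0]
      proof eventually_elim
        case (elim t)
        have "2 *\<^sub>R (x + t *\<^sub>R ((1/2) *\<^sub>R y + (1/2) *\<^sub>R z)) = (x + t *\<^sub>R y) + (x + t *\<^sub>R z)"
          by (simp add: algebra_simps scaleR_2)
        then have "2 * norm (x + t *\<^sub>R ((1/2) *\<^sub>R y + (1/2) *\<^sub>R z))
            \<le> norm (x + t *\<^sub>R y) + norm (x + t *\<^sub>R z)"
          by (metis abs_numeral norm_scaleR norm_triangle_ineq)
        with elim show ?case
          by (simp add: add_divide_distrib[symmetric] divide_right_mono)
      qed
    qed simp
    then show ?thesis by (simp add: algebra_simps)
  qed
  have Dle: "D y \<le> norm y" for y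
  proof (rule tendsto_upperbound[OF Dr])
    show "\<forall>\<^sub>F t in at_right 0. (norm (x + t *\<^sub>R y) - norm x) / t \<le> norm y"
      using eventually_at_right_less[of 0]
    proof eventually_elim
      case (elim t)
      then show ?case using norm_triangle_ineq[of x "t *\<^sub>R y"] by (simp add: field_simps)
    qed
  qed simp
  have Dm: "D (- y) = - D y" for y using Dscale[of "-1" y] by simp
  \<comment> \<open>Oddness turns subadditivity at the negated vectors into the reverse
    inequality.\<close>
  have Dadd: "D (y + z) = D y + D z" for y z
    using Dsub[of y z] Dsub[of "- y" "- z"] Dm[of "y + z"] by (simp add: Dm)
  have Dabs: "\<bar>D y\<bar> \<le> norm y" for y
    using Dle[of y] Dle[of "- y"] Dm[of y] by simp
  have Dx: "D x = 1"
  proof (rule tendsto_unique[OF _ Dr])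
    have "\<forall>\<^sub>F t::real in at_right 0. (norm (x + t *\<^sub>R x) - norm x) / t = 1"
      using eventually_at_right_less[of 0]
    proof eventually_elim
      case (elim t)
      then have "norm (x + t *\<^sub>R x) = 1 + t"
        using assms(2) norm_scaleR[of "1 + t" x] by (simp add: scaleR_add_left)
      with elim assms(2) show ?case by simp
    qed
    then show "((\<lambda>t. (norm (x + t *\<^sub>R x) - norm x) / t) \<longlongrightarrow> 1) (at_right 0)"
      by (rule tendsto_eventually)
  qed simp
  have "bounded_linear D"
    by (rule bounded_linear_intro[where K = 1]) (use Dadd Dscale Dabs in simp_all)
  then have BD: "blinfun_apply (Blinfun D) = D" by (rule bounded_linear_Blinfun_apply)
  show ?thesis
  proof (rule ex1I[of _ "Blinfun D"])
    have "norm (Blinfun D) \<le> 1"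
      by (rule norm_blinfun_bound) (use Dabs in \<open>simp_all add: BD\<close>)
    moreover have "1 \<le> norm (Blinfun D)"
      using norm_blinfun[of "Blinfun D" x] by (simp add: BD Dx assms(2))
    ultimately show "blinfun_apply (Blinfun D) x = 1 \<and> norm (Blinfun D) = 1"
      by (simp add: BD Dx)
  next
    fix f :: "'a \<Rightarrow>\<^sub>L real"
    assume f: "blinfun_apply f x = 1 \<and> norm f = 1"
    \<comment> \<open>Uniqueness: a functional of norm 1 lies below the norm and touches it at
      \<open>x\<close>, so it lies below every right difference quotient; using \<open>y\<close> and
      \<open>- y\<close> then forces equality.\<close>
    have fD: "blinfun_apply f y \<le> D y" for y
    proof (rule tendsto_lowerbound[OF Dr])
      show "\<forall>\<^sub>F t in at_right 0. blinfun_apply f y \<le> (norm (x + t *\<^sub>R y) - norm x) / t"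
        using eventually_at_right_less[of 0]
      proof eventually_elim
        case (elim t)
        have "blinfun_apply f (x + t *\<^sub>R y) \<le> norm (x + t *\<^sub>R y)"
          using norm_blinfun[of f "x + t *\<^sub>R y"] f by simp
        with elim f assms(2) show ?case
          by (simp add: blinfun.add_right blinfun.scaleR_right field_simps)
      qed
    qed simp
    show "f = Blinfun D"
    proof (rule blinfun_eqI)
      show "blinfun_apply f y = blinfun_apply (Blinfun D) y" for y
        using fD[of y] fD[of "- y"] by (simp add: BD Dm blinfun.minus_right)
    qed
  qed
qed

text \<open>The definite description needs unique existence. Dividing by the norm of
  \<open>x\<close> reduces it to the unit sphere, while at 0 only the zero functional
  qualifies.\<close>

lemma duality_map_norming:
  fixes x :: "'a::real_normed_vector"
  assumes "smooth_space TYPE('a)"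
  shows "duality_map x x = (norm x)\<^sup>2" and "norm (duality_map x) = norm x"
proof -
  have "\<exists>!f :: 'a \<Rightarrow>\<^sub>L real. blinfun_apply f x = (norm x)\<^sup>2 \<and> (norm x)\<^sup>2 = (norm f)\<^sup>2"
  proof (cases "x = 0")
    case False
    define r where "r = norm x"
    have r: "r > 0" using False by (simp add: r_def)
    have eq: "blinfun_apply f x = (norm x)\<^sup>2 \<and> (norm x)\<^sup>2 = (norm f)\<^sup>2 \<longleftrightarrow>
        blinfun_apply (inverse r *\<^sub>R f) (sgn x) = 1 \<and> norm (inverse r *\<^sub>R f) = 1" for f :: "'a \<Rightarrow>\<^sub>L real"
      using r unfolding r_def[symmetric] sgn_div_norm
      by (auto simp: blinfun.scaleR_left blinfun.scaleR_right field_simps power2_eq_square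
          power2_eq_iff_nonneg[unfolded power2_eq_square])
    obtain g :: "'a \<Rightarrow>\<^sub>L real" where g: "blinfun_apply g (sgn x) = 1 \<and> norm g = 1"
      and uniq: "\<And>h. blinfun_apply h (sgn x) = 1 \<and> norm h = 1 \<Longrightarrow> h = g"
      using ex_norming_functional[OF assms, of "sgn x"] False by (metis norm_sgn)
    show ?thesis
    proof (rule ex1I[of _ "r *\<^sub>R g"])
      show "blinfun_apply (r *\<^sub>R g) x = (norm x)\<^sup>2 \<and> (norm x)\<^sup>2 = (norm (r *\<^sub>R g))\<^sup>2"
        unfolding eq using g r by simp
      show "f = r *\<^sub>R g" if "blinfun_apply f x = (norm x)\<^sup>2 \<and> (norm x)\<^sup>2 = (norm f)\<^sup>2" for f
        using uniq[of "inverse r *\<^sub>R f"] that[unfolded eq] r by auto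
    qed
  qed auto
  from theI'[OF this] show "duality_map x x = (norm x)\<^sup>2" "norm (duality_map x) = norm x"
    unfolding duality_map_def by auto
qed

section \<open>Second differences bounded above through the duality mapping\<close>

lemma duality_map_subgradient:
  fixes v w :: "'a::real_normed_vector"
  assumes "smooth_space TYPE('a)"
  shows "(norm v)\<^sup>2 + 2 * duality_map v (w - v) \<le> (norm w)\<^sup>2"
proof -
  have "duality_map v w \<le> norm v * norm w"
    using norm_blinfun[of "duality_map v" w] duality_map_norming(2)[OF assms, of v] by simp
  moreover have "2 * (norm v * norm w) \<le> (norm v)\<^sup>2 + (norm w)\<^sup>2"
    using sum_squares_bound[of "norm v" "norm w"] by simp
  ultimately show ?thesis
    using duality_map_norming(1)[OF assms, of v] by (simp add: blinfun.diff_right)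
qed

text \<open>Subgradients are taken at the outer points \<open>x + y\<close> and \<open>x - y\<close>
  and tested at the centre \<open>x\<close>. Their sum bounds the second difference by twice the
  value at \<open>y\<close> of the difference of the two functionals; the points differ by
  \<open>2 *\<^sub>R y\<close>, which yields the factor 4.\<close>

lemma second_difference_upper:
  fixes x y :: "'a::real_normed_vector"
  assumes "smooth_space TYPE('a)"
    and J: "\<And>x y :: 'a. (duality_map x - duality_map y) (x - y) \<le> L * (norm (x - y))\<^sup>2"
  shows "(norm (x + y))\<^sup>2 + (norm (x - y))\<^sup>2 - 2 * (norm x)\<^sup>2 \<le> 4 * L * (norm y)\<^sup>2"
proof -
  have "x + y - (x - y) = 2 *\<^sub>R y" by (simp add: scaleR_2)
  then have "2 * (duality_map (x + y) y - duality_map (x - y) y) \<le> L * (2 * norm y)\<^sup>2"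
    using J[of "x + y" "x - y"] by (simp add: blinfun.diff_left blinfun.scaleR_right algebra_simps)
  then show ?thesis
    using duality_map_subgradient[OF assms(1), of "x + y" x]
      duality_map_subgradient[OF assms(1), of "x - y" x]
    by (simp add: blinfun.minus_right power_mult_distrib)
qed

section \<open>Uniform convexity\<close>

lemma unit_sphere_convexity:
  fixes u v :: "'a::real_normed_vector"
  assumes "\<And>\<epsilon>. \<epsilon> > 0 \<Longrightarrow> modulus_of_convexity TYPE('a) \<epsilon> \<ge> ereal (C * \<epsilon>\<^sup>2)"
    and "norm u = 1" "norm v = 1"
  shows "norm (u + v) \<le> 2 - 2 * C * (norm (u - v))\<^sup>2"
proof (cases "u = v")
  case True
  then have "u + v = 2 *\<^sub>R v" by (simp add: scaleR_2)
  with True assms show ?thesis by simp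
next
  case False
  have "ereal (C * (norm (u - v))\<^sup>2) \<le> modulus_of_convexity TYPE('a) (norm (u - v))"
    using assms(1) False by simp
  also have "\<dots> \<le> ereal (1 - norm (u + v) / 2)"
    unfolding modulus_of_convexity_def using assms(2,3) by (intro Inf_lower) blast
  finally show ?thesis by simp
qed

text \<open>The estimate on the unit sphere extends to all pairs by separating the radial gap
  \<open>r - s\<close> from the angular gap \<delta>. The 1/2 in the constant cancels the 2 from
  squaring a sum of two terms, and \<open>C\<close> is the angular gain.\<close>

lemma midpoint_convexity:
  fixes u v :: "'a::real_normed_vector"
  assumes C: "C > 0"
    and mod: "\<And>u v :: 'a. norm u = 1 \<Longrightarrow> norm v = 1 \<Longrightarrow> norm (u + v) \<le> 2 - 2 * C * (norm (u - v))\<^sup>2"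
  shows "min (1/2) C * (norm (u - v))\<^sup>2 \<le> 2 * (norm u)\<^sup>2 + 2 * (norm v)\<^sup>2 - (norm (u + v))\<^sup>2"
proof -
  let ?c = "min (1/2) C"
  have *: "?c * (norm (u - v))\<^sup>2 \<le> 2 * (norm u)\<^sup>2 + 2 * (norm v)\<^sup>2 - (norm (u + v))\<^sup>2"
    if le: "norm v \<le> norm u" for u v :: 'a
  proof (cases "v = 0")
    case True
    have "?c * (norm u)\<^sup>2 \<le> 1 * (norm u)\<^sup>2" by (intro mult_right_mono) auto
    then show ?thesis by (simp add: True)
  next
    case False
    define r s where "r = norm u" and "s = norm v"
    define p q where "p = sgn u" and "q = sgn v"
    have s0: "s > 0" and sr: "s \<le> r" using False le by (auto simp: r_def s_def)
    then have u0: "u \<noteq> 0" by (auto simp: r_def)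
    have u: "u = r *\<^sub>R p" and v: "v = s *\<^sub>R q"
      using u0 False by (simp_all add: r_def s_def p_def q_def sgn_div_norm)
    have np: "norm p = 1" "norm q = 1" using u0 False by (simp_all add: p_def q_def norm_sgn)
    define \<delta> where "\<delta> = norm (p - q)"
    have m: "norm (p + q) \<le> 2 - 2 * C * \<delta>\<^sup>2" unfolding \<delta>_def by (rule mod[OF np])
    then have C1: "C * \<delta>\<^sup>2 \<le> 1" using norm_ge_zero[of "p + q"] by linarith
    \<comment> \<open>The excess length of the longer vector is split off, leaving two vectors of
      equal length \<open>s\<close> to which the sphere estimate applies.\<close>
    have "u + v = (r - s) *\<^sub>R p + s *\<^sub>R (p + q)" by (simp add: u v algebra_simps)
    then have "norm (u + v) \<le> (r - s) + s * norm (p + q)"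
      using norm_triangle_ineq[of "(r - s) *\<^sub>R p" "s *\<^sub>R (p + q)"] s0 sr np by simp
    also have "\<dots> \<le> (r - s) + s * (2 - 2 * C * \<delta>\<^sup>2)"
      using m s0 by simp
    finally have "norm (u + v) \<le> r + s - 2 * (s * (C * \<delta>\<^sup>2))"
      by (simp add: algebra_simps)
    then have n1: "(norm (u + v))\<^sup>2 \<le> (r + s - 2 * (s * (C * \<delta>\<^sup>2)))\<^sup>2"
      by (intro power_mono) auto
    define k where "k = s * (C * \<delta>\<^sup>2)"
    have k: "0 \<le> k" "k \<le> s"
      using s0 C C1 by (auto simp: k_def mult_left_le)
    \<comment> \<open>From \<open>k \<le> s \<le> r\<close> it follows that \<open>r + s - k\<close>
      is at least \<open>s\<close>, so the square drops by a multiple of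
      \<open>k * s\<close>.\<close>
    have "k * s \<le> k * (r + s - k)" 
      using k sr by (intro mult_left_mono) auto
    moreover have "(r + s - 2 * k)\<^sup>2 = (r + s)\<^sup>2 - 4 * (k * (r + s - k))"
      by (simp add: power2_eq_square algebra_simps)
    ultimately have n2: "(r + s - 2 * k)\<^sup>2 \<le> (r + s)\<^sup>2 - 4 * (k * s)"
      by linarith
    have "u - v = (r - s) *\<^sub>R p + s *\<^sub>R (p - q)" by (simp add: u v algebra_simps)
    then have "norm (u - v) \<le> (r - s) + s * \<delta>"
      using norm_triangle_ineq[of "(r - s) *\<^sub>R p" "s *\<^sub>R (p - q)"] s0 sr np by (simp add: \<delta>_def)
    then have "(norm (u - v))\<^sup>2 \<le> ((r - s) + s * \<delta>)\<^sup>2"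
      by (intro power_mono) auto
    also have "\<dots> \<le> 2 * (r - s)\<^sup>2 + 2 * (s * \<delta>)\<^sup>2"
      using sum_squares_bound[of "r - s" "s * \<delta>"] by (simp add: power2_sum)
    finally have "?c * (norm (u - v))\<^sup>2 \<le> ?c * (2 * (r - s)\<^sup>2 + 2 * (s * \<delta>)\<^sup>2)"
      using C by (intro mult_left_mono) auto
    also have "\<dots> = ?c * (2 * (r - s)\<^sup>2) + ?c * (2 * (s * \<delta>)\<^sup>2)"
      by (simp add: distrib_left)
    also have "\<dots> \<le> (1/2) * (2 * (r - s)\<^sup>2) + C * (2 * (s * \<delta>)\<^sup>2)"
      by (intro add_mono mult_right_mono) auto
    also have "\<dots> = (r - s)\<^sup>2 + 2 * (k * s)"
      by (simp add: k_def power2_eq_square algebra_simps)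
    also have "\<dots> \<le> (r - s)\<^sup>2 + 4 * (k * s)"
      using k s0 by simp
    \<comment> \<open>Here \<open>(r - s)\<^sup>2 + (r + s)\<^sup>2 = 2 * r\<^sup>2 + 2 *
      s\<^sup>2\<close> combines with the bound on \<open>norm (u + v)\<close>.\<close>
    also have "\<dots> \<le> 2 * r\<^sup>2 + 2 * s\<^sup>2 - (norm (u + v))\<^sup>2"
      using n1 n2 unfolding k_def[symmetric] by (simp add: power2_eq_square algebra_simps)
    finally show ?thesis by (simp add: r_def s_def)
  qed
  show ?thesis
    using *[of u v] *[of v u] by (cases "norm v \<le> norm u") (auto simp: norm_minus_commute add.commute)
qed

text \<open>The midpoint estimate is applied to \<open>x + y\<close> and \<open>x - y\<close>, whose
  sum and difference are \<open>2 *\<^sub>R x\<close> and \<open>2 *\<^sub>R y\<close>; halving the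
  result gives the constant \<open>2 * c\<close>.\<close>

lemma second_difference_lower:
  assumes "two_uniformly_convex TYPE('a::real_normed_vector)"
  obtains c where "c > 0"
    "\<And>x y :: 'a. c * (norm y)\<^sup>2 \<le> (norm (x + y))\<^sup>2 + (norm (x - y))\<^sup>2 - 2 * (norm x)\<^sup>2"
proof -
  obtain C where C: "C > 0" "\<And>\<epsilon>. \<epsilon> > 0 \<Longrightarrow> modulus_of_convexity TYPE('a) \<epsilon> \<ge> ereal (C * \<epsilon>\<^sup>2)"
    using assms unfolding two_uniformly_convex_def by blast
  have sphere: "norm (u + v) \<le> 2 - 2 * C * (norm (u - v))\<^sup>2"
    if "norm u = 1" "norm v = 1" for u v :: 'a
    using unit_sphere_convexity[OF C(2) that] .
  define c where "c = min (1/2) C"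
  have "2 * c * (norm y)\<^sup>2 \<le> (norm (x + y))\<^sup>2 + (norm (x - y))\<^sup>2 - 2 * (norm x)\<^sup>2" for x y :: 'a
  proof -
    have e: "x + y - (x - y) = 2 *\<^sub>R y" "x + y + (x - y) = 2 *\<^sub>R x"
      by (simp_all add: scaleR_2)
    have n: "(norm (2 *\<^sub>R v))\<^sup>2 = 4 * (norm v)\<^sup>2" for v :: 'a
      by (simp add: power_mult_distrib)
    show ?thesis
      using midpoint_convexity[OF C(1) sphere, of "x + y" "x - y"]
      unfolding e n c_def[symmetric] by linarith
  qed
  moreover have "2 * c > 0" using C(1) by (simp add: c_def)
  ultimately show ?thesis using that by blast
qed

theorem theorem3p5:
  fixes L :: real
  assumes "two_uniformly_convex TYPE('a::banach)"
    and "smooth_space TYPE('a)"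
    and "L > 0"
    and "\<And>x y :: 'a. blinfun_apply (duality_map x - duality_map y) (x - y) \<le> L * (norm (x - y))\<^sup>2"
  shows "isomorphic_to_hilbert_space TYPE('a)"
proof -
  obtain c where c: "c > 0"
    "\<And>x y :: 'a. c * (norm y)\<^sup>2 \<le> (norm (x + y))\<^sup>2 + (norm (x - y))\<^sup>2 - 2 * (norm x)\<^sup>2"
    using second_difference_lower[OF assms(1)] by blast
  obtain Q :: "'a \<Rightarrow> real" where Q: "\<And>y. c * (norm y)\<^sup>2 \<le> Q y" "\<And>y. Q y \<le> 4 * L * (norm y)\<^sup>2"
    "\<And>y z. Q (y + z) + Q (y - z) = 2 * Q y + 2 * Q z"
    using ex_parallelogram_function[where f = "\<lambda>x. (norm x)\<^sup>2" and l = "\<lambda>y. c * (norm y)\<^sup>2"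
        and u = "\<lambda>y. 4 * L * (norm y)\<^sup>2", OF c(2) second_difference_upper[OF assms(2,4)]] by blast
  have "0 \<le> Q y" for y
    using Q(1)[of y] c(1) by (smt (verit) mult_nonneg_nonneg zero_le_power2)
  from parallelogram_imp_inner_product[OF Q(3) this Q(2)]
  obtain B where B: "\<And>x y. B x y = B y x" "\<And>x y z. B (x + y) z = B x z + B y z"
    "\<And>a x y. B (a *\<^sub>R x) y = a * B x y" "\<And>x. B x x = Q x" by blast
  show ?thesis
    by (rule isomorphic_to_hilbert_space_equivalent_inner_product[where C = "4 * L", OF B(1-3) c(1)])
      (simp_all only: B(4) Q(1,2))
qed

end
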